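(* Let $m,n$ be positive integers and let $G\in\overline G_{m,n}$. Then $G$ is not bipartite.
   Context: All graphs are finite and simple. For positive integers $m,n$, $G_{m,n}$ denotes the class of all simple graphs that have the same degree sequence as the disjoint union $K_m\cup K_n$ of two cliques but are not isomorphic to $K_m\cup K_n$. $\overline G_{m,n}$ denotes the class of complements of graphs in $G_{m,n}$; equivalently, the graphs on $m+n$ vertices with $n$ vertices of degree $m$ and $m$ further vertices of degree $n$ that are not isomorphic to the complete bipartite graph $K_{m,n}$. *)

theory Defs
  imports
    "Graph_Theory.Digraph_Isomorphism"
    "Graph_Theory.Kuratowski"
    "HOL-Library.Multiset"
begin

text \<open>
  A finite simple graph is a \<^locale>\<open>pair_graph\<close>: a finite, loop-free digraph with symmetric arc
  relation whose arcs are pairs of vertices. An undirected edge \<open>{u, v}\<close> is thus represented by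
  the two arcs \<open>(u, v)\<close> and \<open>(v, u)\<close>, so that both the in-degree and the out-degree of a vertex
  are its degree in the undirected graph.
\<close>

definition degree_sequence :: "('a, 'b) pre_digraph \<Rightarrow> nat list" where
  "degree_sequence G = rev (sorted_list_of_multiset (image_mset (out_degree G) (mset_set (verts G))))"

definition bipartite :: "('a, 'b) pre_digraph \<Rightarrow> bool" where
  "bipartite G \<longleftrightarrow> (\<exists>A B. verts G = A \<union> B \<and> A \<inter> B = {} \<and> arcs_ends G \<subseteq> A \<times> B \<union> B \<times> A)"

definition complete_graph :: "nat \<Rightarrow> nat pair_pre_digraph" where
  "complete_graph n = \<lparr> pverts = {..<n}, parcs = {(u, v). u < n \<and> v < n \<and> u \<noteq> v} \<rparr>"

definition disjoint_union ::
    "'a pair_pre_digraph \<Rightarrow> 'b pair_pre_digraph \<Rightarrow> ('a + 'b) pair_pre_digraph" where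
  "disjoint_union G H =
     \<lparr> pverts = pverts G <+> pverts H,
       parcs = map_prod Inl Inl ` parcs G \<union> map_prod Inr Inr ` parcs H \<rparr>"

definition graph_complement :: "'a pair_pre_digraph \<Rightarrow> 'a pair_pre_digraph" where
  "graph_complement G =
     \<lparr> pverts = pverts G,
       parcs = {(u, v). u \<in> pverts G \<and> v \<in> pverts G \<and> u \<noteq> v \<and> (u, v) \<notin> parcs G} \<rparr>"

definition two_cliques :: "nat \<Rightarrow> nat \<Rightarrow> (nat + nat) pair_pre_digraph" where
  "two_cliques m n = disjoint_union (complete_graph m) (complete_graph n)"

text \<open>The classes $G_{m,n}$ and $\overline G_{m,n}$, with vertices taken from the type \<open>'a\<close>:\<close>

definition G_class :: "nat \<Rightarrow> nat \<Rightarrow> 'a pair_pre_digraph set" where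
  "G_class m n =
     {G. pair_graph G
       \<and> degree_sequence (with_proj G) = degree_sequence (with_proj (two_cliques m n))
       \<and> \<not> digraph_iso (with_proj G) (with_proj (two_cliques m n))}"

definition co_G_class :: "nat \<Rightarrow> nat \<Rightarrow> 'a pair_pre_digraph set" where
  "co_G_class m n = graph_complement ` G_class m n"

lemma complete_graph_is_complete_digraph: "K\<^bsub>n\<^esub> (with_proj (complete_graph n))"
  by (auto simp: complete_digraph_pair_def complete_graph_def)

lemma pair_graph_two_cliques: "pair_graph (two_cliques m n)"
proof -
  have "finite ({(u, v). u < k \<and> v < k \<and> u \<noteq> v} :: (nat \<times> nat) set)" for k
    by (rule finite_subset[of _ "{..<k} \<times> {..<k}"]) auto
  then show ?thesis
    by unfold_locales
      (auto simp: two_cliques_def disjoint_union_def complete_graph_def symmetric_def intro!: symI)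
qed

lemma pair_graph_graph_complement:
  assumes "pair_graph G"
  shows "pair_graph (graph_complement G)"
proof -
  interpret pair_graph G by fact
  have sym: "(u, v) \<in> parcs G \<Longrightarrow> (v, u) \<in> parcs G" for u v
    using sym_arcs by (auto simp: symmetric_def dest: symD)
  have "finite (parcs (graph_complement G))"
    by (rule finite_subset[of _ "pverts G \<times> pverts G"]) (auto simp: graph_complement_def)
  then show ?thesis
    using pair_finite_verts sym
    by unfold_locales (auto simp: graph_complement_def symmetric_def intro!: symI)
qed

end

theory Submission
  imports Defs
begin

text \<open>
  Let \<open>G\<close> be the complement of \<open>H\<close>, where \<open>H\<close> has the degrees of \<open>K\<^sub>m \<union> K\<^sub>n\<close>, and put
  \<open>p = min m n\<close> and \<open>q = max m n\<close>. A bipartition of \<open>G\<close> is a partition of the \<open>p + q\<close> vertices of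
  \<open>H\<close> into two cliques \<open>A\<close> and \<open>B\<close>, and a vertex of a clique with \<open>k\<close> vertices has degree at
  least \<open>k - 1\<close>. Some vertex of \<open>H\<close> has degree \<open>p - 1\<close>; if it lies in \<open>A\<close>, then \<open>A\<close> has at most \<open>p\<close>
  vertices. No vertex has degree above \<open>q - 1\<close>, so \<open>B\<close> has at most \<open>q\<close> vertices. Since the sizes add
  up to \<open>p + q\<close>, both bounds are attained. Then each vertex of \<open>B\<close> already has \<open>q - 1\<close> neighbours
  inside \<open>B\<close>, which leaves no edge between \<open>A\<close> and \<open>B\<close>
  (\<open>two_clique_partition_is_disjoint_union\<close>). So \<open>H\<close> is isomorphic to \<open>K\<^sub>m \<union> K\<^sub>n\<close>
  (\<open>iso_two_cliquesI\<close>), which the definition of \<open>G_class\<close> excludes.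

  The number of vertices and the set of degrees of \<open>H\<close> come from the degree sequence: they are the
  size and the set of elements of the multiset that it sorts.
\<close>

lemma out_degree_with_proj: "out_degree (with_proj G) u = card {v. (u, v) \<in> parcs G}"
proof -
  have "out_arcs (with_proj G) u = Pair u ` {v. (u, v) \<in> parcs G}"
    by (auto simp: out_arcs_def)
  then show ?thesis
    by (simp add: out_degree_def card_image inj_on_def)
qed

lemma degree_sequence_eq_imp_degree_mset_eq:
  assumes "degree_sequence G = degree_sequence H"
  shows "image_mset (out_degree G) (mset_set (verts G)) = image_mset (out_degree H) (mset_set (verts H))"
  using arg_cong[OF assms, of mset] by (simp add: degree_sequence_def)

lemma pverts_two_cliques: "pverts (two_cliques m n) = {..<m} <+> {..<n}"
  by (simp add: two_cliques_def disjoint_union_def complete_graph_def)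

lemma parcs_two_cliques:
  "parcs (two_cliques m n) =
     {(x, y). x \<noteq> y \<and> (x \<in> Inl ` {..<m} \<and> y \<in> Inl ` {..<m} \<or> x \<in> Inr ` {..<n} \<and> y \<in> Inr ` {..<n})}"
  by (force simp: two_cliques_def disjoint_union_def complete_graph_def)

lemma degrees_two_cliques:
  assumes "m > 0" "n > 0"
  shows "out_degree (with_proj (two_cliques m n)) ` pverts (two_cliques m n) = {m - 1, n - 1}"
proof -
  have l: "out_degree (with_proj (two_cliques m n)) (Inl i) = m - 1" if "i < m" for i
  proof -
    have "{v. (Inl i, v) \<in> parcs (two_cliques m n)} = Inl ` ({..<m} - {i})"
      using that by (auto simp: parcs_two_cliques)
    then show ?thesis using that by (simp add: out_degree_with_proj card_image)
  qed
  have r: "out_degree (with_proj (two_cliques m n)) (Inr i) = n - 1" if "i < n" for i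
  proof -
    have "{v. (Inr i, v) \<in> parcs (two_cliques m n)} = Inr ` ({..<n} - {i})"
      using that by (auto simp: parcs_two_cliques)
    then show ?thesis using that by (simp add: out_degree_with_proj card_image)
  qed
  have "out_degree (with_proj (two_cliques m n)) ` Inl ` {..<m} = {m - 1}"
    using l assms(1) by force
  moreover have "out_degree (with_proj (two_cliques m n)) ` Inr ` {..<n} = {n - 1}"
    using r assms(2) by force
  ultimately show ?thesis
    by (simp add: pverts_two_cliques Plus_def image_Un insert_commute)
qed

text \<open>
  Any bijections from \<open>A\<close> and \<open>B\<close> onto the two cliques combine to an isomorphism, because the
  arcs on both sides are determined by the partition alone.
\<close>

lemma (in pair_graph) iso_two_cliquesI:
  assumes V: "pverts G = A \<union> B" "A \<inter> B = {}"
    and E: "parcs G = {(u, v). u \<noteq> v \<and> (u \<in> A \<and> v \<in> A \<or> u \<in> B \<and> v \<in> B)}"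
    and card: "card A = m" "card B = n"
  shows "digraph_iso (with_proj G) (with_proj (two_cliques m n))"
proof -
  have "finite A" "finite B" using pair_finite_verts V by auto
  then obtain f g where f: "bij_betw f A {..<m}" and g: "bij_betw g B {..<n}"
    using card ex_bij_betw_finite_nat by (metis atLeast0LessThan)
  define h where "h u = (if u \<in> A then Inl (f u) else Inr (g u))" for u
  define I where "I = \<lparr>iso_verts = h, iso_arcs = map_prod h h, iso_head = snd, iso_tail = fst\<rparr>"
  have hA: "h ` A = Inl ` {..<m}" using f by (auto simp: h_def bij_betw_def)
  have hB: "h ` B = Inr ` {..<n}"
  proof -
    have "h ` B = Inr ` g ` B" using V(2) by (force simp: h_def)
    then show ?thesis using g by (simp add: bij_betw_def)
  qed
  have inj: "inj_on h (pverts G)"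
    using f g V(1) by (auto simp: h_def bij_betw_def inj_on_def)
  have "inj_on (map_prod h h) (parcs G)"
    by (rule inj_on_subset[OF map_prod_inj_on[OF inj inj]]) (use wellformed' in auto)
  then have "digraph_isomorphism I"
    using inj wf_digraph_axioms by (auto simp: digraph_isomorphism_def I_def)
  moreover have "parcs (two_cliques m n) = map_prod h h ` parcs G"
  proof (intro set_eqI iffI)
    fix e assume "e \<in> parcs (two_cliques m n)"
    then show "e \<in> map_prod h h ` parcs G"
      unfolding parcs_two_cliques hA[symmetric] hB[symmetric] E by force
  next
    fix e assume "e \<in> map_prod h h ` parcs G"
    then obtain u v where uv: "e = (h u, h v)" "(u, v) \<in> parcs G" by auto
    have "h u \<noteq> h v"
      using inj uv(2) wellformed' no_loops' by (metis inj_onD)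
    then show "e \<in> parcs (two_cliques m n)"
      using uv unfolding parcs_two_cliques hA[symmetric] hB[symmetric] E by auto
  qed
  moreover have "pverts (two_cliques m n) = h ` pverts G"
    by (simp add: pverts_two_cliques Plus_def V(1) image_Un hA hB)
  ultimately have "digraph_isomorphism I \<and> with_proj (two_cliques m n) = app_iso I (with_proj G)"
    by (simp add: app_iso_def I_def with_proj_def)
  then show ?thesis unfolding digraph_iso_def by blast
qed

lemma (in pair_graph) finite_neighbours: "finite {v. (u, v) \<in> parcs G}"
proof (rule finite_subset[OF _ pair_finite_verts])
  show "{v. (u, v) \<in> parcs G} \<subseteq> pverts G"
    by (rule subsetI) (simp add: in_arcsD2)
qed

lemma (in pair_graph) card_closed_neighbourhood:
  "card (insert u {v. (u, v) \<in> parcs G}) = Suc (out_degree (with_proj G) u)"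
proof -
  have "(u, u) \<notin> parcs G" by (rule notI) (drule no_loops', simp)
  then show ?thesis
    using finite_neighbours by (simp add: out_degree_with_proj)
qed

lemma (in pair_graph) clique_subset_closed_neighbourhood:
  assumes "\<forall>u\<in>C. \<forall>v\<in>C. u \<noteq> v \<longrightarrow> (u, v) \<in> parcs G" "u \<in> C"
  shows "C \<subseteq> insert u {v. (u, v) \<in> parcs G}"
proof
  fix v assume "v \<in> C"
  then show "v \<in> insert u {v. (u, v) \<in> parcs G}"
    using assms by (cases "u = v") simp_all
qed

lemma (in pair_graph) clique_card_le_Suc_degree:
  assumes "\<forall>u\<in>C. \<forall>v\<in>C. u \<noteq> v \<longrightarrow> (u, v) \<in> parcs G" "u \<in> C"
  shows "card C \<le> Suc (out_degree (with_proj G) u)"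
proof -
  have "finite (insert u {v. (u, v) \<in> parcs G})" using finite_neighbours by simp
  then have "card C \<le> card (insert u {v. (u, v) \<in> parcs G})"
    by (rule card_mono) (rule clique_subset_closed_neighbourhood[OF assms])
  then show ?thesis by (simp only: card_closed_neighbourhood)
qed

text \<open>
  The equality case of the previous bound, which rules out edges that leave the clique.
\<close>

lemma (in pair_graph) clique_eq_closed_neighbourhood:
  assumes "\<forall>u\<in>C. \<forall>v\<in>C. u \<noteq> v \<longrightarrow> (u, v) \<in> parcs G" "u \<in> C"
    and "out_degree (with_proj G) u < card C"
  shows "C = insert u {v. (u, v) \<in> parcs G}"
proof (rule card_seteq)
  show "finite (insert u {v. (u, v) \<in> parcs G})" using finite_neighbours by simp
  show "C \<subseteq> insert u {v. (u, v) \<in> parcs G}" by (rule clique_subset_closed_neighbourhood[OF assms(1,2)])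
  show "card (insert u {v. (u, v) \<in> parcs G}) \<le> card C"
    unfolding card_closed_neighbourhood using assms(3) by simp
qed

text \<open>
  The counting core. The two degree bounds limit the sizes of the cliques from above, the number
  of vertices forces equality, and a clique whose size meets the degree bound has no edges leaving it.
\<close>

lemma (in pair_graph) two_clique_partition_is_disjoint_union:
  assumes V: "pverts G = A \<union> B" "A \<inter> B = {}"
    and A: "\<forall>u\<in>A. \<forall>v\<in>A. u \<noteq> v \<longrightarrow> (u, v) \<in> parcs G"
    and B: "\<forall>u\<in>B. \<forall>v\<in>B. u \<noteq> v \<longrightarrow> (u, v) \<in> parcs G"
    and card: "card (pverts G) = p + q"
    and low: "a \<in> A" "out_degree (with_proj G) a < p"
    and high: "\<forall>u\<in>pverts G. out_degree (with_proj G) u < q"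
  shows "card A = p" "card B = q"
    and "parcs G = {(u, v). u \<noteq> v \<and> (u \<in> A \<and> v \<in> A \<or> u \<in> B \<and> v \<in> B)}"
proof -
  have fin: "finite A" "finite B" using pair_finite_verts V by auto
  have sum: "card A + card B = p + q"
    using card V fin by (simp add: card_Un_disjoint)
  have highB: "out_degree (with_proj G) b < q" if "b \<in> B" for b
    using high V(1) that by blast
  have "card A \<le> p"
    using clique_card_le_Suc_degree[OF A low(1)] low(2) by linarith
  moreover have "card B \<le> q"
  proof (cases "B = {}")
    case False
    then obtain b where b: "b \<in> B" by blast
    show ?thesis
      using clique_card_le_Suc_degree[OF B b] highB[OF b] by linarith
  qed simp
  ultimately show cards: "card A = p" "card B = q" using sum by auto
  have B_closed: "v \<in> B" if "b \<in> B" "(b, v) \<in> parcs G" for b v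
  proof -
    have "B = insert b {v. (b, v) \<in> parcs G}"
      by (rule clique_eq_closed_neighbourhood[OF B that(1)]) (simp add: highB[OF that(1)] cards(2))
    moreover have "v \<in> insert b {v. (b, v) \<in> parcs G}" using that(2) by simp
    ultimately show ?thesis by (rule ssubst)
  qed
  show "parcs G = {(u, v). u \<noteq> v \<and> (u \<in> A \<and> v \<in> A \<or> u \<in> B \<and> v \<in> B)}" (is "_ = ?R")
  proof (intro equalityI subrelI)
    fix u v assume uv: "(u, v) \<in> parcs G"
    have "u \<in> A \<union> B" "v \<in> A \<union> B" "u \<noteq> v"
      using wellformed'[OF uv] no_loops'[OF uv] V(1) by simp_all
    moreover have "u \<in> B \<longleftrightarrow> v \<in> B"
      using B_closed[OF _ uv] B_closed[OF _ arcs_symmetric[OF uv]] by iprover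
    ultimately show "(u, v) \<in> ?R" by auto
  next
    fix u v assume "(u, v) \<in> ?R"
    then show "(u, v) \<in> parcs G" using A B by auto
  qed
qed

theorem proposition9:
  fixes m n :: nat and G :: "'a pair_pre_digraph"
  assumes "m > 0" and "n > 0"
    and "G \<in> co_G_class m n"
  shows "\<not> bipartite (with_proj G)"
proof
  assume bip: "bipartite (with_proj G)"
  obtain H where G: "G = graph_complement H" and H: "H \<in> G_class m n"
    using assms(3) by (auto simp: co_G_class_def)
  interpret H: pair_graph H using H by (simp add: G_class_def)
  have not_iso: "\<not> digraph_iso (with_proj H) (with_proj (two_cliques m n))"
    and seq: "degree_sequence (with_proj H) = degree_sequence (with_proj (two_cliques m n))"
    using H by (auto simp: G_class_def)
  note degs = degree_sequence_eq_imp_degree_mset_eq[OF seq]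
  have "card (pverts H) = card (pverts (two_cliques m n))"
    using arg_cong[OF degs, of size] by simp
  then have card: "card (pverts H) = min m n + max m n"
    by (simp add: pverts_two_cliques card_Plus)
  have deg: "out_degree (with_proj H) ` pverts H = {m - 1, n - 1}"
    using arg_cong[OF degs, of set_mset] H.pair_finite_verts degrees_two_cliques[OF assms(1,2)]
    by (simp add: pverts_two_cliques)
  have "min m n - 1 \<in> out_degree (with_proj H) ` pverts H" unfolding deg by (simp add: min_def)
  then obtain a where a: "a \<in> pverts H" "out_degree (with_proj H) a = min m n - 1" by force
  have low: "out_degree (with_proj H) a < min m n" using a(2) assms(1,2) by linarith
  have high: "\<forall>u\<in>pverts H. out_degree (with_proj H) u < max m n"
  proof
    fix u assume "u \<in> pverts H"
    then have "out_degree (with_proj H) u \<in> {m - 1, n - 1}" using deg by blast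
    then show "out_degree (with_proj H) u < max m n" using assms(1,2) by auto
  qed
  \<comment> \<open>The two colour classes play symmetric roles, so \<open>A\<close> is chosen as the one containing \<open>a\<close>.\<close>
  obtain A B where AB: "pverts G = A \<union> B" "A \<inter> B = {}" "parcs G \<subseteq> A \<times> B \<union> B \<times> A" "a \<in> A"
  proof -
    obtain A B where *: "pverts G = A \<union> B" "A \<inter> B = {}" "parcs G \<subseteq> A \<times> B \<union> B \<times> A"
      using bip by (auto simp: bipartite_def)
    have "a \<in> A \<union> B" using a(1) *(1) by (simp add: G graph_complement_def)
    then show ?thesis using that[of A B] that[of B A] * by blast
  qed
  have V: "pverts H = A \<union> B" using AB(1) by (simp add: G graph_complement_def)
  have arc: "(u, v) \<in> parcs H"
    if "u \<in> pverts H" "v \<in> pverts H" "u \<noteq> v" "(u, v) \<notin> A \<times> B \<union> B \<times> A" for u v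
    using that AB(3) by (auto simp: G graph_complement_def)
  have cliques: "\<forall>u\<in>A. \<forall>v\<in>A. u \<noteq> v \<longrightarrow> (u, v) \<in> parcs H"
    "\<forall>u\<in>B. \<forall>v\<in>B. u \<noteq> v \<longrightarrow> (u, v) \<in> parcs H"
    using arc V AB(2) by blast+
  note sizes_arcs = H.two_clique_partition_is_disjoint_union[OF V AB(2) cliques card AB(4) low high]
  show False
  proof (cases "m \<le> n")
    case True
    then show False
      using H.iso_two_cliquesI[OF V AB(2) sizes_arcs(3), of m n] sizes_arcs(1,2) not_iso by simp
  next
    case False
    \<comment> \<open>Now \<open>n\<close> is the smaller number, so \<open>B\<close> is matched with \<open>K\<^sub>m\<close> and \<open>A\<close> with \<open>K\<^sub>n\<close>.\<close>
    have "pverts H = B \<union> A" "B \<inter> A = {}"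
      "parcs H = {(u, v). u \<noteq> v \<and> (u \<in> B \<and> v \<in> B \<or> u \<in> A \<and> v \<in> A)}"
      using V AB(2) sizes_arcs(3) by auto
    from H.iso_two_cliquesI[OF this, of m n] show False
      using False sizes_arcs(1,2) not_iso by simp
  qed
qed

end
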